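(* Let $n$ be an even positive integer. Then the stacked-book graph $G_{3,n}=S_3\Box P_n$ satisfies $$rn(G_{3,n})\leq \frac{3n^2}{2}+n.$$
   Context: $S_3$ denotes the star on $3$ vertices (a center vertex adjacent to two leaves, i.e. a path on 3 vertices viewed as a star) and $P_n$ the path on $n$ vertices. The stacked-book graph $G_{3,n}=S_3 \Box P_n$ is their Cartesian product. For a simple connected graph $G$ with distance $d$ and diameter $\mathrm{diam}(G)$, a radio labeling is a function $f:V(G)\to \mathbb{Z}_{\ge 0}$ such that $|f(u)-f(v)|\geq \mathrm{diam}(G)+1-d(u,v)$ for all distinct $u,v\in V(G)$. The span of $f$ is $\max_{v} f(v)-\min_{v} f(v)$. The radio number $rn(G)$ is the minimum span over all radio labelings of $G$. *)

theory Defs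
  imports Complex_Main
begin

text \<open>A simple undirected graph is given by its vertex set and a symmetric, irreflexive
  edge relation on it; every undirected edge occurs in both orientations.\<close>

record 'a graph =
  verts :: "'a set"
  edges :: "('a \<times> 'a) set"

definition simple_graph :: "'a graph \<Rightarrow> bool" where
  "simple_graph G \<longleftrightarrow>
     finite (verts G) \<and> edges G \<subseteq> verts G \<times> verts G \<and> sym (edges G) \<and> irrefl (edges G)"

definition connected_graph :: "'a graph \<Rightarrow> bool" where
  "connected_graph G \<longleftrightarrow>
     verts G \<noteq> {} \<and> (\<forall>u\<in>verts G. \<forall>v\<in>verts G. (u, v) \<in> (edges G)\<^sup>*)"

text \<open>The pair \<open>(u, v)\<close> lies in the \<open>k\<close>-th relational power of the edge relation iff there is
  a walk with \<open>k\<close> edges from \<open>u\<close> to \<open>v\<close>. The value is meaningful only if \<open>u\<close> and \<open>v\<close> are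
  connected.\<close>

definition graph_dist :: "'a graph \<Rightarrow> 'a \<Rightarrow> 'a \<Rightarrow> nat" where
  "graph_dist G u v = (LEAST k. (u, v) \<in> edges G ^^ k)"

definition graph_diam :: "'a graph \<Rightarrow> nat" where
  "graph_diam G = Max {graph_dist G u v | u v. u \<in> verts G \<and> v \<in> verts G}"

definition radio_labeling :: "'a graph \<Rightarrow> ('a \<Rightarrow> nat) \<Rightarrow> bool" where
  "radio_labeling G f \<longleftrightarrow>
     (\<forall>u\<in>verts G. \<forall>v\<in>verts G. u \<noteq> v \<longrightarrow>
        \<bar>int (f u) - int (f v)\<bar> \<ge> int (graph_diam G) + 1 - int (graph_dist G u v))"

definition label_span :: "'a graph \<Rightarrow> ('a \<Rightarrow> nat) \<Rightarrow> nat" where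
  "label_span G f = Max (f ` verts G) - Min (f ` verts G)"

definition radio_number :: "'a graph \<Rightarrow> nat" where
  "radio_number G = (LEAST s. \<exists>f. radio_labeling G f \<and> label_span G f = s)"

text \<open>The star on \<open>m\<close> vertices in total: the center \<open>0\<close> and the leaves \<open>1, \<dots>, m - 1\<close>.\<close>

definition star_graph :: "nat \<Rightarrow> nat graph" where
  "star_graph m = \<lparr>verts = {..<m},
     edges = {(u, v). u < m \<and> v < m \<and> u \<noteq> v \<and> (u = 0 \<or> v = 0)}\<rparr>"

definition path_graph :: "nat \<Rightarrow> nat graph" where
  "path_graph n = \<lparr>verts = {..<n},
     edges = {(u, v). u < n \<and> v < n \<and> (v = Suc u \<or> u = Suc v)}\<rparr>"

definition cartesian_product :: "'a graph \<Rightarrow> 'b graph \<Rightarrow> ('a \<times> 'b) graph" where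
  "cartesian_product G H = \<lparr>verts = verts G \<times> verts H,
     edges = {((a, b), (c, d)).
        (a = c \<and> a \<in> verts G \<and> (b, d) \<in> edges H) \<or>
        (b = d \<and> b \<in> verts H \<and> (a, c) \<in> edges G)}\<rparr>"

definition stacked_book :: "nat \<Rightarrow> nat \<Rightarrow> (nat \<times> nat) graph" where
  "stacked_book m n = cartesian_product (star_graph m) (path_graph n)"

lemma simple_graph_stacked_book: "simple_graph (stacked_book m n)"
  by (auto simp: simple_graph_def stacked_book_def cartesian_product_def star_graph_def
      path_graph_def sym_def irrefl_def)

lemma connected_graph_stacked_book:
  assumes "m > 0" "n > 0"
  shows "connected_graph (stacked_book m n)"
proof -
  let ?E = "edges (stacked_book m n)"
  have sym: "sym (?E\<^sup>*)"
    using simple_graph_stacked_book[of m n] by (simp add: simple_graph_def sym_rtrancl)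
  have down: "((a, b), (a, 0)) \<in> ?E\<^sup>*" if "a < m" "b < n" for a b
    using that(2)
  proof (induction b)
    case (Suc b)
    have "((a, Suc b), (a, b)) \<in> ?E"
      using that(1) Suc.prems
      by (auto simp: stacked_book_def cartesian_product_def star_graph_def path_graph_def)
    then show ?case
      using Suc by (meson Suc_lessD converse_rtrancl_into_rtrancl)
  qed simp
  have "((a, 0), (0, 0)) \<in> ?E\<^sup>*" if "a < m" for a
  proof (cases "a = 0")
    case False
    then have "((a, 0), (0, 0)) \<in> ?E"
      using that assms
      by (auto simp: stacked_book_def cartesian_product_def star_graph_def path_graph_def)
    then show ?thesis by blast
  qed simp
  with down have root: "((a, b), (0, 0)) \<in> ?E\<^sup>*" if "a < m" "b < n" for a b
    using that by (meson rtrancl_trans)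
  have verts: "verts (stacked_book m n) = {..<m} \<times> {..<n}"
    by (simp add: stacked_book_def cartesian_product_def star_graph_def path_graph_def)
  show ?thesis
    unfolding connected_graph_def verts
  proof (intro conjI ballI)
    fix u v assume "u \<in> {..<m} \<times> {..<n}" "v \<in> {..<m} \<times> {..<n}"
    then have "(u, (0, 0)) \<in> ?E\<^sup>*" "(v, (0, 0)) \<in> ?E\<^sup>*"
      using root by auto
    then show "(u, v) \<in> ?E\<^sup>*"
      using sym by (meson rtrancl_trans symD)
  qed (use assms in auto)
qed

text \<open>The minimum defining the radio number ranges over a nonempty set.\<close>

lemma radio_labeling_exists:
  assumes "simple_graph G"
  shows "\<exists>f. radio_labeling G f"
proof -
  obtain g :: "'a \<Rightarrow> nat" where g: "inj_on g (verts G)"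
    using assms finite_imp_inj_to_nat_seg[of "verts G"] by (auto simp: simple_graph_def)
  define D where "D = int (graph_diam G) + 1"
  have "radio_labeling G (\<lambda>v. g v * nat D)"
    unfolding radio_labeling_def
  proof (intro ballI impI)
    fix u v assume "u \<in> verts G" "v \<in> verts G" "u \<noteq> v"
    with g have "g u \<noteq> g v"
      by (auto simp: inj_on_def)
    then have "1 \<le> \<bar>int (g u) - int (g v)\<bar>"
      by linarith
    then have "D \<le> \<bar>int (g u) - int (g v)\<bar> * D"
      using mult_right_mono[of 1 "\<bar>int (g u) - int (g v)\<bar>" D] by (simp add: D_def)
    also have "\<dots> = \<bar>int (g u * nat D) - int (g v * nat D)\<bar>"
      by (simp add: D_def abs_mult flip: left_diff_distrib)
    finally show "int (graph_diam G) + 1 - int (graph_dist G u v)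
        \<le> \<bar>int (g u * nat D) - int (g v * nat D)\<bar>"
      by (simp add: D_def)
  qed
  then show ?thesis by blast
qed

end

theory Submission
  imports Defs
begin

text \<open>Write \<open>n = 2k\<close> and list all \<open>3n\<close> vertices so that the levels run three times through
  \<open>k - 1, 2k - 1, k - 2, 2k - 2, \<dots>, 0, k\<close> while the pages run cyclically through center, leaf,
  leaf; if \<open>3\<close> divides \<open>n\<close>, the cycle skips one page after each pass, so that every level meets
  every page. Give consecutive vertices labels that differ by exactly \<open>n + 2\<close> minus their
  distance. Consecutive vertices lie in opposite halves and never on the same page, so their
  distances add up to twice the total distance of all vertices from the middle of the book, up to
  the two ends of the list; this yields the span. Vertices two places apart satisfy the radio
  condition because three consecutive pages are distinct except where a pass ends, and there a
  step of length one on the path makes up for it. From three places on, the labels differ by at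
  least the diameter.\<close>

section \<open>Radio labelings obtained from an ordering of the vertices\<close>

lemma graph_dist_commute:
  assumes "sym (edges G)"
  shows "graph_dist G u v = graph_dist G v u"
proof -
  have "(edges G ^^ k)\<inverse> = edges G ^^ k" for k
  proof (induction k)
    case (Suc k)
    have "(edges G ^^ Suc k)\<inverse> = (edges G)\<inverse> O (edges G ^^ k)\<inverse>"
      by (simp add: converse_relcomp)
    also have "\<dots> = edges G O edges G ^^ k"
      using assms Suc.IH by (simp add: sym_conv_converse_eq)
    finally show ?case
      by (simp add: relpow_commute)
  qed simp
  then show ?thesis
    unfolding graph_dist_def by (metis converse_iff)
qed

text \<open>Since \<open>F\<close> increases along the list, the pairs three or more places apart
  all reduce to gaps of exactly three. There \<open>three\<close> asks for only the diameter,
  without the summand 1, because distinct vertices have distance at least 1.\<close>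

lemma radio_labeling_of_ordering:
  fixes F :: "nat \<Rightarrow> nat"
  assumes x: "bij_betw x {..<N} (verts G)"
    and sym: "sym (edges G)"
    and mono: "mono F"
    and pos: "\<And>u v. u \<in> verts G \<Longrightarrow> v \<in> verts G \<Longrightarrow> u \<noteq> v \<Longrightarrow> graph_dist G u v > 0"
    and one: "\<And>t. t + 1 < N \<Longrightarrow>
      F t + graph_diam G + 1 \<le> F (t + 1) + graph_dist G (x t) (x (t + 1))"
    and two: "\<And>t. t + 2 < N \<Longrightarrow>
      F t + graph_diam G + 1 \<le> F (t + 2) + graph_dist G (x t) (x (t + 2))"
    and three: "\<And>t. t + 3 < N \<Longrightarrow> F t + graph_diam G \<le> F (t + 3)"
  shows "radio_labeling G (\<lambda>v. F (the_inv_into {..<N} x v))"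
proof -
  have inj: "inj_on x {..<N}" and img: "x ` {..<N} = verts G"
    using x by (auto simp: bij_betw_def)
  have less: "F s + graph_diam G + 1 \<le> F t + graph_dist G (x s) (x t)"
    if st: "s < t" "t < N" for s t
  proof -
    consider "t = s + 1" | "t = s + 2" | "s + 3 \<le> t"
      using st(1) by linarith
    then show ?thesis
    proof cases
      case 3
      have "x s \<noteq> x t"
        using inj st by (auto dest: inj_onD)
      moreover have "x s \<in> verts G" "x t \<in> verts G"
        using st img by auto
      ultimately have "graph_dist G (x s) (x t) > 0"
        using pos by blast
      moreover have "F (s + 3) \<le> F t"
        using mono 3 by (rule monoD)
      ultimately show ?thesis
        using three[of s] st 3 by linarith
    qed (use one[of s] two[of s] st in simp_all)
  qed
  show ?thesis
    unfolding radio_labeling_def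
  proof (intro ballI impI)
    fix u v assume "u \<in> verts G" "v \<in> verts G" "u \<noteq> v"
    then obtain s t where st: "u = x s" "v = x t" "s < N" "t < N" "s \<noteq> t"
      unfolding img[symmetric] by auto
    then show "\<bar>int (F (the_inv_into {..<N} x u)) - int (F (the_inv_into {..<N} x v))\<bar>
        \<ge> int (graph_diam G) + 1 - int (graph_dist G u v)"
      using less[of s t] less[of t s] graph_dist_commute[OF sym, of u v]
      by (cases "s < t") (auto simp: the_inv_into_f_f[OF inj])
  qed
qed

lemma radio_number_le:
  assumes "radio_labeling G f" "finite (verts G)" "verts G \<noteq> {}"
    "\<And>v. v \<in> verts G \<Longrightarrow> f v \<le> s"
  shows "radio_number G \<le> s"
proof -
  have "radio_number G \<le> label_span G f"
    unfolding radio_number_def using assms(1) by (intro Least_le) auto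
  also have "Max (f ` verts G) \<le> s"
    using assms(2,3,4) by simp
  then have "label_span G f \<le> s"
    by (simp add: label_span_def)
  finally show ?thesis .
qed

section \<open>Distances in the star, the path and the stacked book\<close>

definition star_dist :: "nat \<Rightarrow> nat \<Rightarrow> nat" where
  "star_dist a c = (if a = c then 0 else if a = 0 \<or> c = 0 then 1 else 2)"

text \<open>Let w be the distance of a page from the center. A step is at most the sum of w at its
  two ends, with equality if these differ. So the left side is at most w(a) + 2 w(b) + w(c), where
  w(a) + w(c) is the distance from \<open>a\<close> to \<open>c\<close> and w(b) is at most
  1.\<close>

lemma star_dist_two_steps:
  assumes "a < 3" "b < 3" "c < 3" "a \<noteq> c"
  shows "star_dist a b + star_dist b c \<le> 2 + star_dist a c"
proof -
  have "a = 0 \<or> a = 1 \<or> a = 2" "b = 0 \<or> b = 1 \<or> b = 2" "c = 0 \<or> c = 1 \<or> c = 2"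
    using assms by linarith+
  then show ?thesis
    using assms(4) by (elim disjE) (simp_all add: star_dist_def)
qed

text \<open>A total above 4 needs at least two steps of length 2, and such a step joins the two
  leaves. Two of them in a row would return to the starting page, which is excluded. If the first
  and the last step are of this kind, the middle step joins leaves, and it has length 0 since length
  2 is excluded again.\<close>

lemma star_dist_three_steps:
  assumes "a < 3" "b < 3" "c < 3" "d < 3" "a \<noteq> c" "b \<noteq> d"
  shows "star_dist a b + star_dist b c + star_dist c d \<le> 4"
proof -
  have "a = 0 \<or> a = 1 \<or> a = 2" "b = 0 \<or> b = 1 \<or> b = 2" "c = 0 \<or> c = 1 \<or> c = 2"
    "d = 0 \<or> d = 1 \<or> d = 2"
    using assms by linarith+
  then show ?thesis
    using assms(5,6) by (elim disjE) (simp_all add: star_dist_def)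
qed

text \<open>This is the absolute difference: with truncated subtraction one of the two summands is
  0.\<close>

definition path_dist :: "nat \<Rightarrow> nat \<Rightarrow> nat" where
  "path_dist b d = (b - d) + (d - b)"

lemma verts_stacked_book: "verts (stacked_book m n) = {..<m} \<times> {..<n}"
  by (simp add: stacked_book_def cartesian_product_def star_graph_def path_graph_def)

lemma edges_stacked_book:
  "((a, b), (c, d)) \<in> edges (stacked_book m n) \<longleftrightarrow>
     a < m \<and> b < n \<and> c < m \<and> d < n \<and>
     (a = c \<and> (d = Suc b \<or> b = Suc d) \<or> b = d \<and> a \<noteq> c \<and> (a = 0 \<or> c = 0))"
  by (auto simp: stacked_book_def cartesian_product_def star_graph_def path_graph_def)

text \<open>An edge changes only one coordinate, and it changes the sum of the two coordinate
  distances by at most 1. This is the lower bound for the distance; the explicit walks below give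
  the upper bound.\<close>

lemma stacked_book_walk_length:
  assumes "((a, b), (c, d)) \<in> edges (stacked_book m n) ^^ l"
  shows "star_dist a c + path_dist b d \<le> l"
  using assms
proof (induction l arbitrary: c d)
  case 0
  then show ?case by (simp add: star_dist_def path_dist_def)
next
  case (Suc l)
  then obtain c' d' where
    "((a, b), (c', d')) \<in> edges (stacked_book m n) ^^ l"
    and e: "((c', d'), (c, d)) \<in> edges (stacked_book m n)"
    by auto
  then have "star_dist a c' + path_dist b d' \<le> l"
    using Suc.IH by blast
  then show ?case
    using e unfolding edges_stacked_book
    by (auto simp: star_dist_def path_dist_def split: if_splits)
qed

lemma stacked_book_path_walk:
  assumes "a < m" "b < n" "d < n"
  shows "((a, b), (a, d)) \<in> edges (stacked_book m n) ^^ path_dist b d"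
proof -
  have up: "((a, b), (a, b + l)) \<in> edges (stacked_book m n) ^^ l" if "b + l < n" for b l
    using that
  proof (induction l)
    case (Suc l)
    then have "((a, b + l), (a, b + Suc l)) \<in> edges (stacked_book m n)"
      using assms(1) by (simp add: edges_stacked_book)
    with Suc show ?case by auto
  qed simp
  have down: "((a, b + l), (a, b)) \<in> edges (stacked_book m n) ^^ l" if "b + l < n" for b l
    using that
  proof (induction l arbitrary: b)
    case (Suc l)
    then have "((a, Suc b), (a, b)) \<in> edges (stacked_book m n)"
      using assms(1) by (simp add: edges_stacked_book)
    with Suc.IH[of "Suc b"] Suc.prems show ?case by auto
  qed simp
  show ?thesis
  proof (cases "b \<le> d")
    case True
    then show ?thesis using up[of b "d - b"] assms by (simp add: path_dist_def)
  next
    case False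
    then show ?thesis using down[of d "b - d"] assms by (simp add: path_dist_def)
  qed
qed

lemma stacked_book_star_walk:
  assumes "a < m" "c < m" "d < n"
  shows "((a, d), (c, d)) \<in> edges (stacked_book m n) ^^ star_dist a c"
proof -
  have "((a, d), (c, d)) \<in> edges (stacked_book m n) ^^ 2" if "a \<noteq> 0" "c \<noteq> 0"
  proof -
    have "((a, d), (0, d)) \<in> edges (stacked_book m n)"
      "((0, d), (c, d)) \<in> edges (stacked_book m n)"
      using assms that by (auto simp: edges_stacked_book)
    then show ?thesis by (auto simp: numeral_2_eq_2)
  qed
  then show ?thesis
    using assms by (auto simp: star_dist_def edges_stacked_book)
qed

lemma graph_dist_stacked_book:
  assumes "a < m" "b < n" "c < m" "d < n"
  shows "graph_dist (stacked_book m n) (a, b) (c, d) = star_dist a c + path_dist b d"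
  unfolding graph_dist_def
proof (rule Least_equality)
  show "((a, b), (c, d)) \<in> edges (stacked_book m n) ^^ (star_dist a c + path_dist b d)"
    using stacked_book_star_walk[of a m c b n] stacked_book_path_walk[of c m b n d] assms
    unfolding relpow_add by blast
qed (rule stacked_book_walk_length)

text \<open>An upper bound suffices: labels that satisfy the radio condition with a larger value in
  place of the diameter satisfy it with the diameter.\<close>

lemma graph_diam_stacked_book_le:
  assumes "m > 0" "n > 0"
  shows "graph_diam (stacked_book m n) \<le> n + 1"
proof -
  let ?G = "stacked_book m n"
  let ?S = "{graph_dist ?G u v | u v. u \<in> verts ?G \<and> v \<in> verts ?G}"
  have "?S = (\<lambda>(u, v). graph_dist ?G u v) ` (verts ?G \<times> verts ?G)"
    by auto
  then have "finite ?S"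
    by (simp add: verts_stacked_book)
  moreover have "(0, 0) \<in> verts ?G"
    using assms by (simp add: verts_stacked_book)
  then have "?S \<noteq> {}"
    by blast
  moreover have "w \<le> n + 1" if "w \<in> ?S" for w
    using that by (auto simp: verts_stacked_book graph_dist_stacked_book star_dist_def path_dist_def)
  ultimately show ?thesis
    unfolding graph_diam_def by simp
qed

section \<open>The zigzag order: levels and the lengths of their steps\<close>

definition zigzag_level :: "nat \<Rightarrow> nat \<Rightarrow> nat" where
  "zigzag_level k t = (let j = t mod (2 * k) in
     if even j then k - 1 - j div 2 else 2 * k - 1 - j div 2)"

definition zigzag_page :: "nat \<Rightarrow> nat \<Rightarrow> nat" where
  "zigzag_page n t = (t + (if 3 dvd n then t div n else 0)) mod 3"

text \<open>These are the three kinds of steps: from the lower to the upper half, back to the lower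
  half, and the turn from the end of one pass to the start of the next.\<close>

lemma mod_double_cases:
  fixes k t :: nat
  assumes "k > 0"
  obtains i where "i < k" "t mod (2 * k) = 2 * i" "Suc t mod (2 * k) = 2 * i + 1"
  | i where "i + 1 < k" "t mod (2 * k) = 2 * i + 1" "Suc t mod (2 * k) = 2 * i + 2"
  | "t mod (2 * k) = 2 * k - 1" "Suc t mod (2 * k) = 0"
proof -
  define j where "j = t mod (2 * k)"
  have j: "j < 2 * k" "Suc t mod (2 * k) = (if Suc j = 2 * k then 0 else Suc j)"
    using assms by (auto simp: j_def mod_Suc)
  show ?thesis
  proof (cases "even j")
    case True
    then obtain i where "j = 2 * i" by blast
    moreover from this have "Suc j \<noteq> 2 * k" by presburger
    ultimately show ?thesis using that(1)[of i] j by (simp add: j_def)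
  next
    case False
    then obtain i where "j = 2 * i + 1" by (rule oddE)
    then show ?thesis
      using that(2)[of i] that(3) j by (cases "Suc j = 2 * k") (auto simp: j_def)
  qed
qed

lemma zigzag_level_less: "k > 0 \<Longrightarrow> zigzag_level k t < 2 * k"
  by (auto simp: zigzag_level_def Let_def)

text \<open>Even positions of a pass have levels below \<open>k\<close> and odd ones have levels
  from \<open>k\<close> on, so the level determines the parity; on each half it decreases strictly
  with the position.\<close>

lemma zigzag_level_inj:
  assumes "k > 0" "zigzag_level k s = zigzag_level k t"
  shows "s mod (2 * k) = t mod (2 * k)"
proof -
  define i j where "i = s mod (2 * k)" and "j = t mod (2 * k)"
  then have "i < 2 * k" "j < 2 * k"
    using assms(1) by auto
  moreover have "(if even i then k - 1 - i div 2 else 2 * k - 1 - i div 2) =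
      (if even j then k - 1 - j div 2 else 2 * k - 1 - j div 2)"
    using assms(2) unfolding zigzag_level_def Let_def i_def j_def .
  ultimately have "i = j"
    by (cases "even i"; cases "even j") (auto elim!: evenE oddE)
  then show ?thesis
    by (simp add: i_def j_def)
qed

lemma zigzag_level_even: "t mod (2 * k) = 2 * i \<Longrightarrow> zigzag_level k t = k - 1 - i"
  and zigzag_level_odd: "t mod (2 * k) = 2 * i + 1 \<Longrightarrow> zigzag_level k t = 2 * k - 1 - i"
  by (simp_all add: zigzag_level_def)

lemma zigzag_level_last:
  assumes "k > 0" "t mod (2 * k) = 2 * k - 1"
  shows "zigzag_level k t = k"
proof -
  have "t mod (2 * k) = 2 * (k - 1) + 1"
    using assms by linarith
  from zigzag_level_odd[OF this] show ?thesis
    using assms(1) by linarith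
qed

lemma zigzag_level_first: "t mod (2 * k) = 0 \<Longrightarrow> zigzag_level k t = k - 1"
  using zigzag_level_even[of t k 0] by simp

lemma zigzag_level_step:
  assumes "k > 0"
  shows "path_dist (zigzag_level k t) (zigzag_level k (Suc t)) =
    (if 2 * k dvd Suc t then 1 else if even t then k else k + 1)"
proof (cases rule: mod_double_cases[OF assms, of t])
  case (1 i)
  moreover have "even t"
    using 1(2) by (metis dvd_mod_iff dvd_triv_left)
  moreover have "\<not> 2 * k dvd Suc t"
    using 1(3) by (simp add: dvd_eq_mod_eq_0)
  ultimately show ?thesis
    by (simp add: zigzag_level_even[OF 1(2)] zigzag_level_odd[OF 1(3)] path_dist_def)
next
  case (2 i)
  have "odd t"
    using 2(2) by (metis dvd_mod_iff dvd_triv_left odd_two_times_div_two_succ even_plus_one_iff)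
  moreover have "\<not> 2 * k dvd Suc t"
    using 2(3) by (simp add: dvd_eq_mod_eq_0)
  moreover have "Suc t mod (2 * k) = 2 * (i + 1)"
    using 2(3) by simp
  ultimately show ?thesis
    using 2(1) zigzag_level_even[of "Suc t" k "i + 1"]
    by (simp add: zigzag_level_odd[OF 2(2)] path_dist_def)
next
  case 3
  then show ?thesis
    using assms
    by (simp add: zigzag_level_first zigzag_level_last path_dist_def dvd_eq_mod_eq_0)
qed

text \<open>By the triangle inequality the direct distance is at least the difference of the two
  steps. Hence the sum of the steps exceeds it by at most twice the shorter one, which is 1 at a
  turn and \<open>k\<close> elsewhere.\<close>

lemma zigzag_level_two_steps:
  assumes "k > 0"
  shows "path_dist (zigzag_level k t) (zigzag_level k (t + 1)) +
      path_dist (zigzag_level k (t + 1)) (zigzag_level k (t + 2)) \<le>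
    (if 2 * k dvd t + 1 \<or> 2 * k dvd t + 2 then 2 else 2 * k) +
      path_dist (zigzag_level k t) (zigzag_level k (t + 2))"
proof -
  let ?D = "\<lambda>s t. path_dist (zigzag_level k s) (zigzag_level k t)"
  have triangle: "path_dist a b \<le> path_dist b c + path_dist a c \<and>
      path_dist b c \<le> path_dist a b + path_dist a c" for a b c
    by (auto simp: path_dist_def)
  have step: "?D t (t + 1) = (if 2 * k dvd t + 1 then 1 else if even t then k else k + 1)"
    "?D (t + 1) (t + 2) = (if 2 * k dvd t + 2 then 1 else if odd t then k else k + 1)"
    using zigzag_level_step[OF assms, of t] zigzag_level_step[OF assms, of "t + 1"] by simp_all
  show ?thesis
    using triangle[of "zigzag_level k t" "zigzag_level k (t + 1)" "zigzag_level k (t + 2)"]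
    unfolding step by (auto split: if_splits)
qed

lemma sum_lessThan_double:
  fixes f :: "nat \<Rightarrow> 'a::comm_monoid_add"
  shows "sum f {..<2 * m} = (\<Sum>i<m. f (2 * i) + f (2 * i + 1))"
  by (induction m) (simp_all add: add.assoc)

lemma sum_three_periods:
  fixes f :: "nat \<Rightarrow> 'a::comm_monoid_add"
  shows "sum f {..<3 * n} = (\<Sum>t<n. f t + f (t + n) + f (t + 2 * n))"
proof -
  have *: "sum f {..<m + n} = sum f {..<m} + (\<Sum>t<n. f (t + m))" for m
    by (induction n) (simp_all add: ac_simps)
  have "sum f {..<3 * n} = sum f {..<(n + n) + n}"
    by (rule arg_cong[where f = "\<lambda>m. sum f {..<m}"]) simp
  also have "\<dots> = (\<Sum>t<n. f t) + (\<Sum>t<n. f (t + n)) + (\<Sum>t<n. f (t + 2 * n))"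
    unfolding * by (simp add: mult_2)
  finally show ?thesis by (simp add: sum.distrib)
qed

text \<open>A pass has \<open>k\<close> steps of length \<open>k\<close>, \<open>k - 1\<close> steps
  of length \<open>k + 1\<close> and a turn of length 1, in total \<open>2 * k^2\<close>. The last
  summand is a fictitious step from the last vertex to index \<open>6 * k\<close>; it makes the
  three passes alike.\<close>

lemma sum_zigzag_level:
  assumes "k > 0"
  shows "(\<Sum>t<6 * k. path_dist (zigzag_level k t) (zigzag_level k (Suc t))) = 6 * k\<^sup>2"
proof -
  let ?D = "\<lambda>t. path_dist (zigzag_level k t) (zigzag_level k (Suc t))"
  have per: "?D (t + 2 * k) = ?D t" for t
    by (simp add: zigzag_level_def flip: add_Suc)
  have per2: "?D (t + 2 * (2 * k)) = ?D t" for t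
    using per[of "t + 2 * k"] per[of t] by (simp add: ac_simps)
  have odd_not_dvd: "\<not> 2 * k dvd Suc (2 * i)" for i
    by (metis dvd_mult_left even_Suc dvd_triv_left)
  have "2 * k dvd Suc (2 * i + 1) \<longleftrightarrow> Suc i = k" if "i < k" for i
  proof -
    have "2 * k dvd Suc (2 * i + 1) \<longleftrightarrow> 2 * k dvd 2 * Suc i"
      by simp
    also have "\<dots> \<longleftrightarrow> k dvd Suc i"
      by (rule nat_mult_dvd_cancel1) simp
    also have "\<dots> \<longleftrightarrow> Suc i = k"
      using that by (auto dest: dvd_imp_le)
    finally show ?thesis .
  qed
  \<comment> \<open>Each pair of steps has lengths \<open>k\<close> and \<open>k + 1\<close>, except
    that the second step of the last pair is the turn.\<close>
  then have "(\<Sum>i<k. ?D (2 * i) + ?D (2 * i + 1)) = (\<Sum>i<k. if Suc i = k then k + 1 else 2 * k + 1)"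
    using odd_not_dvd assms by (intro sum.cong) (auto simp: zigzag_level_step)
  also obtain l where l: "k = Suc l"
    using assms by (cases k) auto
  have "(\<Sum>i<k. if Suc i = k then k + 1 else 2 * k + 1) = 2 * k\<^sup>2"
    unfolding l by (simp add: power2_eq_square)
  finally have "sum ?D {..<2 * k} = 2 * k\<^sup>2"
    by (simp only: sum_lessThan_double)
  then show ?thesis
    using sum_three_periods[of ?D "2 * k"] unfolding per per2 by (simp flip: sum_distrib_left add: sum.distrib)
qed

section \<open>The zigzag order: pages, and each vertex occurring once\<close>

lemma zigzag_page_less: "zigzag_page n t < 3"
  by (simp add: zigzag_page_def)

lemma zigzag_page_cases: "zigzag_page n t = 0 \<or> zigzag_page n t = 1 \<or> zigzag_page n t = 2"
  using zigzag_page_less[of n t] by linarith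

text \<open>One pass later the pages are rotated by a nonzero amount: by \<open>n mod 3\<close> if
  this is nonzero, and otherwise by the 1 that \<open>t div n\<close> gains.\<close>

lemma zigzag_page_period:
  assumes "n > 0"
  obtains c where "c = 1 \<or> c = 2" "\<And>t. zigzag_page n (t + n) = (zigzag_page n t + c) mod 3"
proof (cases "3 dvd n")
  case True
  then have "zigzag_page n (t + n) = (zigzag_page n t + 1) mod 3" for t
  proof -
    have "(t + n + (t div n + 1)) mod 3 = ((t + t div n) mod 3 + 1) mod 3"
    proof -
      obtain q where "n = 3 * q"
        using True by blast
      then have "t + n + (t div n + 1) = (t + t div n + 1) + 3 * q"
        by simp
      then have "(t + n + (t div n + 1)) mod 3 = (t + t div n + 1) mod 3"
        by (metis mod_mult_self2)
      then show ?thesis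
        by (simp only: mod_add_left_eq)
    qed
    then show ?thesis
      using assms True by (simp add: zigzag_page_def)
  qed
  then show ?thesis using that by blast
next
  case False
  then have "n mod 3 = 1 \<or> n mod 3 = 2" by presburger
  moreover have "zigzag_page n (t + n) = (zigzag_page n t + n mod 3) mod 3" for t
    using False by (simp add: zigzag_page_def mod_simps)
  ultimately show ?thesis using that by blast
qed

lemma zigzag_page_step:
  assumes "n > 0"
  shows "zigzag_page n (Suc t) = (zigzag_page n t + (if 3 dvd n \<and> n dvd Suc t then 2 else 1)) mod 3"
proof (cases "3 dvd n \<and> n dvd Suc t")
  case True
  then have "Suc t div n = Suc (t div n)"
    by (simp add: div_Suc dvd_eq_mod_eq_0)
  then show ?thesis
    using True by (simp add: zigzag_page_def mod_simps)
next
  case False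
  then have "3 dvd n \<Longrightarrow> Suc t div n = t div n"
    by (simp add: div_Suc dvd_eq_mod_eq_0)
  then show ?thesis
    using False by (simp add: zigzag_page_def mod_simps)
qed

lemma zigzag_page_neq:
  assumes "n > 0"
  shows "zigzag_page n t \<noteq> zigzag_page n (Suc t)"
  using zigzag_page_cases[of n t] unfolding zigzag_page_step[OF assms, of t]
  by (elim disjE) simp_all

text \<open>Without a skip, two steps advance the page by 2 modulo 3. A skip among them would make
  it 3, a return to the same page.\<close>

lemma zigzag_page_neq2:
  assumes "n > 0" "\<not> (3 dvd n \<and> (n dvd t + 1 \<or> n dvd t + 2))"
  shows "zigzag_page n t \<noteq> zigzag_page n (t + 2)"
proof -
  have "zigzag_page n (t + 1) = (zigzag_page n t + 1) mod 3"
    "zigzag_page n (t + 2) = (zigzag_page n (t + 1) + 1) mod 3"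
    using zigzag_page_step[OF assms(1), of t] zigzag_page_step[OF assms(1), of "t + 1"] assms(2)
    by auto
  then show ?thesis
    using zigzag_page_cases[of n t] by (elim disjE) simp_all
qed

text \<open>Equal levels force the indices to be a whole number \<open>m\<close> of passes apart,
  with \<open>m\<close> equal to 1 or 2 if they differ. The pages are then rotated by
  \<open>m * c\<close>, which is nonzero modulo 3.\<close>

lemma zigzag_inj_on:
  assumes "k > 0"
  shows "inj_on (\<lambda>t. (zigzag_page (2 * k) t, zigzag_level k t)) {..<3 * (2 * k)}"
proof -
  let ?n = "2 * k"
  obtain c where c: "c = 1 \<or> c = 2"
    "\<And>t. zigzag_page ?n (t + ?n) = (zigzag_page ?n t + c) mod 3"
    using zigzag_page_period[of ?n] assms by auto
  have page: "zigzag_page ?n (t + m * ?n) = (zigzag_page ?n t + m * c) mod 3" for t m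
  proof (induction m)
    case 0
    then show ?case using zigzag_page_less[of ?n t] by simp
  next
    case (Suc m)
    have "zigzag_page ?n (t + Suc m * ?n) = (zigzag_page ?n (t + m * ?n) + c) mod 3"
      using c(2)[of "t + m * ?n"] by (simp add: ac_simps)
    then show ?case
      using Suc by (simp add: mod_simps ac_simps)
  qed
  show ?thesis
  proof (rule linorder_inj_onI')
    fix s t assume *: "s \<in> {..<3 * ?n}" "t \<in> {..<3 * ?n}" "s < t"
    show "(zigzag_page ?n s, zigzag_level k s) \<noteq> (zigzag_page ?n t, zigzag_level k t)"
    proof
      assume "(zigzag_page ?n s, zigzag_level k s) = (zigzag_page ?n t, zigzag_level k t)"
      then have eq: "zigzag_page ?n s = zigzag_page ?n t" "zigzag_level k t = zigzag_level k s"
        by simp_all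
      have "?n dvd t - s"
        using zigzag_level_inj[OF assms eq(2)] *(3) mod_eq_dvd_iff_nat[of s t ?n] by simp
      then obtain m where "t - s = ?n * m" ..
      then have m: "t = s + ?n * m"
        using *(3) by linarith
      have "?n * m < ?n * 3"
        using *(2) m unfolding lessThan_iff by linarith
      then have "m < 3"
        by simp
      moreover have "m \<noteq> 0"
        using *(3) m by auto
      ultimately have "m = 1 \<or> m = 2"
        by linarith
      moreover have "zigzag_page ?n s = (zigzag_page ?n s + m * c) mod 3"
        using eq(1) page[of s m] m by (simp add: mult.commute)
      ultimately show False
        using c(1) zigzag_page_cases[of ?n s] by (elim disjE) simp_all
    qed
  qed
qed

text \<open>Consecutive pages differ, so a step is as long as the way through the center and counts
  the leaves among its two ends. Summing counts every leaf in the list twice, and there are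
  \<open>2 * n\<close> of them because \<open>t\<close>, \<open>t + n\<close> and
  \<open>t + 2 * n\<close> lie on three different pages.\<close>

lemma sum_zigzag_page:
  assumes "n > 0"
  shows "(\<Sum>t<3 * n. star_dist (zigzag_page n t) (zigzag_page n (Suc t))) = 4 * n"
proof -
  define w :: "nat \<Rightarrow> nat" where "w t = of_bool (zigzag_page n t \<noteq> 0)" for t
  have "star_dist (zigzag_page n t) (zigzag_page n (Suc t)) = w t + w (Suc t)" for t
    using zigzag_page_neq[OF assms, of t] by (auto simp: star_dist_def w_def)
  then have "(\<Sum>t<3 * n. star_dist (zigzag_page n t) (zigzag_page n (Suc t))) =
      (\<Sum>t<3 * n. w t) + (\<Sum>t<3 * n. w (Suc t))"
    by (simp add: sum.distrib)
  also have "(\<Sum>t<3 * n. w (Suc t)) + w 0 = (\<Sum>t<3 * n. w t) + w (3 * n)"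
    by (metis add.commute sum.lessThan_Suc sum.lessThan_Suc_shift)
  \<comment> \<open>The list starts at the center, and index \<open>3 * n\<close>, one past its end,
    falls on the center again; so shifting the sum by one does not change it.\<close>
  moreover have "w 0 = 0" "w (3 * n) = 0"
    using assms by (auto simp: w_def zigzag_page_def)
  moreover have "w t + w (t + n) + w (t + 2 * n) = 2" for t
  proof -
    obtain c where c: "c = 1 \<or> c = 2"
      "\<And>t. zigzag_page n (t + n) = (zigzag_page n t + c) mod 3"
      using zigzag_page_period[OF assms] by blast
    have "zigzag_page n (t + 2 * n) = (zigzag_page n (t + n) + c) mod 3"
      using c(2)[of "t + n"] by (simp add: mult_2 add.assoc)
    then show ?thesis
      using c(1) c(2)[of t] zigzag_page_cases[of n t]
      by (elim disjE) (simp_all add: w_def)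
  qed
  then have "(\<Sum>t<3 * n. w t) = 2 * n"
    by (simp add: sum_three_periods)
  ultimately show ?thesis
    by simp
qed

section \<open>The labeling, its radio condition and its span\<close>

lemma radio_number_stacked_book_le:
  assumes k: "k > 0"
  shows "radio_number (stacked_book 3 (2 * k)) \<le> 6 * k\<^sup>2 + 2 * k"
proof -
  define n where "n = 2 * k"
  define G where "G = stacked_book 3 n"
  define page where "page = zigzag_page n"
  define level where "level = zigzag_level k"
  define x where "x t = (page t, level t)" for t
  define S where "S s t = star_dist (page s) (page t)" for s t
  define D where "D s t = path_dist (level s) (level t)" for s t
  \<comment> \<open>The truncated subtraction is exact by \<open>step_le\<close>, which gives the
    equation \<open>F_step\<close>.\<close>
  define F where "F t = (\<Sum>s<t. n + 2 - (S s (Suc s) + D s (Suc s)))" for t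
  have n: "n > 0"
    using k by (simp add: n_def)
  have page_less: "page t < 3" for t
    by (simp add: page_def zigzag_page_less)
  have level_less: "level t < n" for t
    using zigzag_level_less[OF k] by (simp add: level_def n_def)
  have page_neq2: "page t \<noteq> page (t + 2)"
    if "\<not> (3 dvd n \<and> (n dvd t + 1 \<or> n dvd t + 2))" for t
    unfolding page_def using n that by (rule zigzag_page_neq2)
  have verts: "verts G = {..<3} \<times> {..<n}"
    by (simp add: G_def verts_stacked_book)
  have dist: "graph_dist G (x s) (x t) = S s t + D s t" for s t
    by (simp add: G_def x_def S_def D_def graph_dist_stacked_book page_less level_less)
  have diam: "graph_diam G \<le> n + 1"
    unfolding G_def using n by (intro graph_diam_stacked_book_le) auto
  have S_le: "S s t \<le> 2" for s t
    by (simp add: S_def star_dist_def)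
  have D_step: "D t (t + 1) = (if n dvd t + 1 then 1 else if even t then k else k + 1)" for t
    using zigzag_level_step[OF k, of t] by (simp add: D_def level_def n_def)
  have step_le: "S t (t + 1) + D t (t + 1) \<le> n + 2" for t
  proof (cases "k = 1")
    case True
    have "D t (t + 1) \<le> 1"
      unfolding D_step using True by (auto simp: n_def)
    then show ?thesis
      using S_le[of t "t + 1"] n by linarith
  next
    case False
    then show ?thesis
      using S_le[of t "t + 1"] k unfolding D_step n_def by (auto split: if_splits)
  qed
  have F_step: "F (t + 1) + (S t (t + 1) + D t (t + 1)) = F t + (n + 2)" for t
    using step_le[of t] by (simp add: F_def)
  have "mono F"
    by (auto simp: F_def mono_def intro!: sum_mono2)
  have S_two: "S t (t + 1) + S (t + 1) (t + 2) \<le>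
      (if 3 dvd n \<and> (n dvd t + 1 \<or> n dvd t + 2) then 4 else 2 + S t (t + 2))" for t
    using S_le[of t "t + 1"] S_le[of "t + 1" "t + 2"] page_neq2[of t]
      star_dist_two_steps[OF page_less page_less page_less, of t "t + 2" "t + 1"]
    unfolding S_def by auto
  have D_two: "D t (t + 1) + D (t + 1) (t + 2) \<le>
      (if n dvd t + 1 \<or> n dvd t + 2 then 2 else 2 * k) + D t (t + 2)" for t
    using zigzag_level_two_steps[OF k, of t] by (simp add: D_def level_def n_def)
  have S_three: "S t (t + 1) + S (t + 1) (t + 2) + S (t + 2) (t + 3) \<le> 4"
    if "\<not> n dvd t + 1" "\<not> n dvd t + 2" "\<not> n dvd t + 3" for t
  proof -
    have "page t \<noteq> page (t + 2)" "page (t + 1) \<noteq> page (t + 3)"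
      using page_neq2[of t] page_neq2[of "t + 1"] that
      by (simp_all add: numeral_2_eq_2 numeral_3_eq_3)
    then show ?thesis
      unfolding S_def by (intro star_dist_three_steps page_less)
  qed
  have bij: "bij_betw x {..<3 * n} (verts G)"
  proof -
    have inj: "inj_on x {..<3 * n}"
      using zigzag_inj_on[OF k] by (simp add: x_def[abs_def] page_def level_def n_def)
    moreover have "x ` {..<3 * n} \<subseteq> verts G"
      by (auto simp: x_def verts page_less level_less)
    moreover have "card (x ` {..<3 * n}) = card (verts G)"
      using inj by (simp add: card_image verts)
    ultimately show ?thesis
      by (simp add: bij_betw_def card_subset_eq verts)
  qed
  have radio: "radio_labeling G (\<lambda>v. F (the_inv_into {..<3 * n} x v))"
  proof (rule radio_labeling_of_ordering[OF bij _ \<open>mono F\<close>])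
    show "sym (edges G)"
      using simple_graph_stacked_book by (simp add: G_def simple_graph_def)
  next
    fix u v assume "u \<in> verts G" "v \<in> verts G" "u \<noteq> v"
    then show "graph_dist G u v > 0"
      by (auto simp: G_def verts_stacked_book graph_dist_stacked_book star_dist_def path_dist_def
          split: if_splits)
  next
    fix t
    show "F t + graph_diam G + 1 \<le> F (t + 1) + graph_dist G (x t) (x (t + 1))"
      using F_step[of t] diam unfolding dist by linarith
  next
    fix t
    \<comment> \<open>Two steps raise the label by \<open>2 * (n + 2)\<close> minus their lengths,
      so this bound is the radio condition with \<open>n + 2\<close> for the diameter plus 1. At a
      skip the pages may use 4, but the levels use only 2 beyond their distance, and 6 is at most
      \<open>n + 2\<close> once \<open>k\<close> is at least 2.\<close>
    have "S t (t + 1) + S (t + 1) (t + 2) + (D t (t + 1) + D (t + 1) (t + 2)) \<le>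
        n + 2 + (S t (t + 2) + D t (t + 2))"
    proof (cases "3 dvd n \<and> (n dvd t + 1 \<or> n dvd t + 2)")
      case True
      then have "n \<ge> 3"
        using n by (auto dest: dvd_imp_le)
      then have "k \<ge> 2"
        by (simp add: n_def)
      then show ?thesis
        using S_two[of t] D_two[of t] True by (simp add: n_def)
    next
      case False
      then show ?thesis
        using S_two[of t] D_two[of t] k by (auto simp: n_def split: if_splits)
    qed
    moreover have "F (t + 2) + (S t (t + 1) + D t (t + 1)) + (S (t + 1) (t + 2) + D (t + 1) (t + 2))
        = F t + 2 * (n + 2)"
      using F_step[of t] F_step[of "t + 1"] by simp
    ultimately show "F t + graph_diam G + 1 \<le> F (t + 2) + graph_dist G (x t) (x (t + 2))"
      using diam by (simp add: dist)
  next
    fix t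
    have D_step': "D (t + 1) (t + 2) = (if n dvd t + 2 then 1 else if odd t then k else k + 1)"
      "D (t + 2) (t + 3) = (if n dvd t + 3 then 1 else if even t then k else k + 1)"
      using D_step[of "t + 1"] D_step[of "t + 2"] by (simp_all add: numeral_3_eq_3)
    \<comment> \<open>Out of \<open>3 * (n + 2)\<close> this leaves a label difference of at least
      \<open>n + 1\<close>, which bounds the diameter.\<close>
    have "S t (t + 1) + S (t + 1) (t + 2) + S (t + 2) (t + 3) +
        (D t (t + 1) + D (t + 1) (t + 2) + D (t + 2) (t + 3)) \<le> 2 * n + 5"
    proof (cases "n dvd t + 1 \<or> n dvd t + 2 \<or> n dvd t + 3")
      case turn: True
      show ?thesis
      proof (cases "k = 1")
        case True
        then have "D t (t + 1) \<le> 1" "D (t + 1) (t + 2) \<le> 1" "D (t + 2) (t + 3) \<le> 1"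
          unfolding D_step D_step' by (auto simp: n_def)
        then show ?thesis
          using S_le[of t "t + 1"] S_le[of "t + 1" "t + 2"] S_le[of "t + 2" "t + 3"] n True
          by (simp add: n_def)
      next
        case False
        \<comment> \<open>Next to a turn of length 1 there are two steps of length at most
          \<open>k + 1\<close>. With at most 6 from the pages, the total \<open>2 * k + 9\<close> is
          within \<open>4 * k + 5\<close> from \<open>k = 2\<close> on.\<close>
        then have "D t (t + 1) + D (t + 1) (t + 2) + D (t + 2) (t + 3) \<le> 2 * k + 3"
          using turn k unfolding D_step D_step' by auto
        then show ?thesis
          using S_le[of t "t + 1"] S_le[of "t + 1" "t + 2"] S_le[of "t + 2" "t + 3"] k False
          by (simp add: n_def)
      qed
    next
      case False
      \<comment> \<open>The extreme case is \<open>k + 1\<close>, \<open>k\<close>,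
        \<open>k + 1\<close>; the saving in \<open>S_three\<close> then gives
        \<open>3 * k + 6\<close>, at most \<open>4 * k + 5\<close>.\<close>
      then have "D t (t + 1) + D (t + 1) (t + 2) + D (t + 2) (t + 3) \<le> 3 * k + 2"
        unfolding D_step D_step' by auto
      then show ?thesis
        using S_three[of t] False k by (simp add: n_def)
    qed
    moreover have "F (t + 3) + (S t (t + 1) + D t (t + 1)) + (S (t + 1) (t + 2) + D (t + 1) (t + 2))
        + (S (t + 2) (t + 3) + D (t + 2) (t + 3)) = F t + 3 * (n + 2)"
      using F_step[of t] F_step[of "t + 1"] F_step[of "t + 2"] by (simp add: numeral_3_eq_3)
    ultimately show "F t + graph_diam G \<le> F (t + 3)"
      using diam by simp
  qed
  have F_sum: "F m + (\<Sum>t<m. S t (Suc t)) + (\<Sum>t<m. D t (Suc t)) = m * (n + 2)" for m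
  proof (induction m)
    case (Suc m)
    then show ?case using F_step[of m] by simp
  qed (simp add: F_def)
  have "F (3 * n) + 4 * n + 6 * k\<^sup>2 = 3 * n * (n + 2)"
    using F_sum[of "3 * n"] sum_zigzag_page[OF n] sum_zigzag_level[OF k]
    by (simp add: S_def D_def page_def level_def n_def)
  \<comment> \<open>The value \<open>F (3 * n)\<close>, which is \<open>6 * k^2 + 4 * k\<close>,
    belongs to the fictitious index after the last vertex \<open>r\<close>. The step to it ends at
    the center and is a turn, so its length is at most 2; undoing it lowers the label by at least
    \<open>n\<close>.\<close>
  moreover obtain r where r: "3 * n = r + 1"
    using n by (metis Suc_eq_plus1 gr0_implies_Suc mult_pos_pos zero_less_numeral)
  have "page (r + 1) = 0"
    unfolding r[symmetric] page_def zigzag_page_def using n by simp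
  then have "S r (r + 1) \<le> 1"
    by (simp add: S_def star_dist_def)
  moreover have "n dvd r + 1"
    unfolding r[symmetric] by simp
  then have "D r (r + 1) = 1"
    unfolding D_step by simp
  moreover have "3 * n * (n + 2) = 12 * k\<^sup>2 + 12 * k"
    by (simp add: n_def power2_eq_square algebra_simps)
  ultimately have F_last: "F r \<le> 6 * k\<^sup>2 + 2 * k"
    using F_step[of r] r n_def by simp
  have "radio_number G \<le> 6 * k\<^sup>2 + 2 * k"
  proof (rule radio_number_le[OF radio])
    show "finite (verts G)" "verts G \<noteq> {}"
      using n by (auto simp: verts lessThan_empty_iff)
  next
    fix v assume "v \<in> verts G"
    then have "the_inv_into {..<3 * n} x v < 3 * n"
      using bij the_inv_into_into[of x "{..<3 * n}" v "{..<3 * n}"]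
      by (auto simp: bij_betw_def)
    then have "F (the_inv_into {..<3 * n} x v) \<le> F r"
      using r by (intro monoD[OF \<open>mono F\<close>]) simp
    then show "F (the_inv_into {..<3 * n} x v) \<le> 6 * k\<^sup>2 + 2 * k"
      using F_last by linarith
  qed
  then show ?thesis
    by (simp add: G_def n_def)
qed

theorem theorem3p13:
  fixes n :: nat
  assumes "even n" and "n > 0"
  shows "real (radio_number (stacked_book 3 n)) \<le> 3 * (real n)\<^sup>2 / 2 + real n"
proof -
  obtain k where k: "n = 2 * k" "k > 0"
    using assms by auto
  then have "real (radio_number (stacked_book 3 n)) \<le> real (6 * k\<^sup>2 + 2 * k)"
    using radio_number_stacked_book_le by (simp only: of_nat_le_iff)
  also have "\<dots> = 3 * (real n)\<^sup>2 / 2 + real n"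
    by (simp add: k power2_eq_square)
  finally show ?thesis .
qed

end
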